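(* Let $q\ge 2$ and $R\ge 1$ be integers, and let $y>1$ and $x>0$ be real numbers satisfying $e^{-x}y^R<1$. Then $$\mu_q^*(R)\leq x\left(\frac{y}{y-1}\right)^R\left(1+\frac{1}{e^{x}y^{-R}-1}\right).$$
   Context: For an integer $q\ge 2$, $[q]=\{1,\dots,q\}$ and $[q]^n$ is the set of words of length $n$ over $[q]$. The Hamming distance between two words is the number of coordinates in which they differ. A covering code of $[q]^n$ of radius $R$ is a set $K\subseteq[q]^n$ such that every $z\in[q]^n$ is at Hamming distance at most $R$ from some element of $K$. Let $V_q(n,R)=\sum_{i=0}^R (q-1)^i\binom{n}{i}$ be the size of a Hamming ball of radius $R$ in $[q]^n$. The density of a covering code $K$ is $|K|\cdot V_q(n,R)/q^n$; $\mu_q(n,R)$ denotes the minimal density of a covering code of $[q]^n$ of radius $R$, and $\mu_q^*(R)=\limsup_{n\to\infty}\mu_q(n,R)$. Logarithms and exponentials are natural. *)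

theory Defs
  imports Complex_Main "HOL-Library.Extended_Real" "HOL-Library.Liminf_Limsup"
begin

definition words :: "nat \<Rightarrow> nat \<Rightarrow> nat list set" where
  "words q n = {w. length w = n \<and> set w \<subseteq> {1..q}}"

text \<open>Only meaningful for two words of the same length.\<close>

definition hamming_dist :: "'a list \<Rightarrow> 'a list \<Rightarrow> nat" where
  "hamming_dist u v = card {i. i < length u \<and> u ! i \<noteq> v ! i}"

definition covering_code :: "nat \<Rightarrow> nat \<Rightarrow> nat \<Rightarrow> nat list set \<Rightarrow> bool" where
  "covering_code q n R K \<longleftrightarrow>
     K \<subseteq> words q n \<and> (\<forall>z \<in> words q n. \<exists>c \<in> K. hamming_dist z c \<le> R)"

definition ball_size :: "nat \<Rightarrow> nat \<Rightarrow> nat \<Rightarrow> nat" where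
  "ball_size q n R = (\<Sum>i = 0..R. (q - 1) ^ i * (n choose i))"

definition density :: "nat \<Rightarrow> nat \<Rightarrow> nat \<Rightarrow> nat list set \<Rightarrow> real" where
  "density q n R K = real (card K) * real (ball_size q n R) / real q ^ n"

definition min_density :: "nat \<Rightarrow> nat \<Rightarrow> nat \<Rightarrow> real" where
  "min_density q n R = Min (density q n R ` {K. covering_code q n R K})"

text \<open>The minimum above is taken over a finite nonempty set.\<close>

lemma finite_words: "finite (words q n)"
  using finite_lists_length_eq[of "{1..q}" n] by (simp add: words_def conj_commute)

lemma finite_covering_codes: "finite {K. covering_code q n R K}"
  by (rule finite_subset[of _ "Pow (words q n)"]) (auto simp: covering_code_def finite_words)

lemma covering_code_words: "covering_code q n R (words q n)"
  unfolding covering_code_def by (auto intro!: bexI simp: hamming_dist_def)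

text \<open>The limit superior is taken in the extended reals, so that no boundedness in \<open>n\<close>
  is presupposed.\<close>

definition limsup_density :: "nat \<Rightarrow> nat \<Rightarrow> ereal" where
  "limsup_density q R = limsup (\<lambda>n. ereal (min_density q n R))"

end

theory Submission
  imports Defs
begin

text \<open>A greedily chosen code of about \<open>x q\<^sup>a / V\<close> words of length \<open>a\<close>, where \<open>V\<close> is the size of
  a ball, leaves at most a fraction \<open>exp (- x)\<close> of the words uncovered. Extend this code by all words
  of length \<open>m\<close>, and extend each uncovered word by an optimal covering code of length \<open>m\<close>; the result
  covers all words of length \<open>n = a + m\<close>. With \<open>m\<close> close to \<open>n / y\<close> this gives, asymptotically,
  \<open>\<mu>(n) \<le> x (y / (y - 1))\<^sup>R + exp (- x) y\<^sup>R \<mu>(m)\<close>, and the limit superior therefore is at most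
  \<open>x (y / (y - 1))\<^sup>R / (1 - exp (- x) y\<^sup>R)\<close>.\<close>

section \<open>Hamming balls\<close>

lemma card_words: "card (words q n) = q ^ n"
  using card_lists_length_eq[of "{1..q}" n] by (simp add: words_def conj_commute)

lemma words_Suc: "words q (Suc n) = (\<lambda>(a, w). a # w) ` ({1..q} \<times> words q n)"
  by (auto simp: words_def length_Suc_conv image_iff)

lemma append_in_words: "u \<in> words q a \<Longrightarrow> v \<in> words q m \<Longrightarrow> u @ v \<in> words q (a + m)"
  by (auto simp: words_def)

lemma words_add_cases:
  assumes "w \<in> words q (a + m)"
  obtains u v where "w = u @ v" "u \<in> words q a" "v \<in> words q m"
proof
  show "w = take a w @ drop a w" by simp
  show "take a w \<in> words q a" "drop a w \<in> words q m"
    using assms set_take_subset[of a w] set_drop_subset[of a w] by (auto simp: words_def)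
qed

lemma hamming_dist_Nil [simp]: "hamming_dist [] v = 0"
  by (simp add: hamming_dist_def)

lemma hamming_dist_Cons [simp]:
  "hamming_dist (a # u) (b # v) = (if a = b then 0 else 1) + hamming_dist u v"
proof -
  have "{i. i < length (a # u) \<and> (a # u) ! i \<noteq> (b # v) ! i}
      = (if a = b then {} else {0}) \<union> Suc ` {i. i < length u \<and> u ! i \<noteq> v ! i}"
  proof (rule set_eqI)
    fix i
    show "i \<in> {i. i < length (a # u) \<and> (a # u) ! i \<noteq> (b # v) ! i} \<longleftrightarrow>
        i \<in> (if a = b then {} else {0}) \<union> Suc ` {i. i < length u \<and> u ! i \<noteq> v ! i}"
      by (cases i) auto
  qed
  then show ?thesis
    by (simp add: hamming_dist_def card_image)
qed

lemma hamming_dist_self [simp]: "hamming_dist u u = 0"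
  by (simp add: hamming_dist_def)

lemma hamming_dist_append:
  "length u = length u' \<Longrightarrow>
    hamming_dist (u @ v) (u' @ v') = hamming_dist u u' + hamming_dist v v'"
  by (induction u u' rule: list_induct2) auto

text \<open>Induction on the length, splitting off the first letter: either it agrees with that of
  \<open>z\<close> and the tail has distance \<open>i\<close>, or it is one of \<open>q - 1\<close>
  other letters and the tail has distance \<open>i - 1\<close>. Pascal's rule adds the two
  counts.\<close>

lemma card_hamming_sphere:
  assumes "z \<in> words q n"
  shows "card {w \<in> words q n. hamming_dist z w = i} = (q - 1) ^ i * (n choose i)"
  using assms
proof (induction n arbitrary: z i)
  case 0
  then have "{w \<in> words q 0. hamming_dist z w = i} = (if i = 0 then {[]} else {})"
    by (auto simp: words_def)
  then show ?case by (simp add: binomial_eq_0)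
next
  case (Suc n)
  then obtain a u where z: "z = a # u" "a \<in> {1..q}" "u \<in> words q n"
    by (auto simp: words_Suc)
  let ?S = "\<lambda>j. {w \<in> words q n. hamming_dist u w = j}"
  have fin: "finite (?S j)" for j
    using finite_words by simp
  have inj: "inj_on (\<lambda>(b, w). b # w) A" for A :: "(nat \<times> nat list) set"
    by (auto simp: inj_on_def)
  have split: "{w \<in> words q (Suc n). hamming_dist z w = i}
      = (\<lambda>(b, w). b # w) ` ({a} \<times> ?S i \<union> (if i = 0 then {} else ({1..q} - {a}) \<times> ?S (i - 1)))"
    using z by (auto simp: words_Suc image_iff split: if_splits)
  show ?case
  proof (cases i)
    case 0
    then show ?thesis
      unfolding split card_image[OF inj] using Suc.IH[OF z(3), of 0]
      by (simp add: card_cartesian_product)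
  next
    case (Suc j)
    have "card ({a} \<times> ?S i \<union> ({1..q} - {a}) \<times> ?S j) = card (?S i) + (q - 1) * card (?S j)"
      using z(2) fin by (subst card_Un_disjoint) (auto simp: card_cartesian_product)
    \<comment> \<open>Writing \<open>q\<close> as a successor removes the truncated subtraction from
      \<open>q - 1\<close>.\<close>
    moreover obtain p where "q = Suc p"
      using z(2) by (cases q) auto
    ultimately show ?thesis
      unfolding split card_image[OF inj] using Suc.IH[OF z(3)] \<open>i = Suc j\<close>
      by (simp add: algebra_simps)
  qed
qed

lemma card_hamming_ball:
  assumes "z \<in> words q n"
  shows "card {w \<in> words q n. hamming_dist z w \<le> R} = ball_size q n R"
proof -
  have "{w \<in> words q n. hamming_dist z w \<le> R}
      = (\<Union>i\<in>{0..R}. {w \<in> words q n. hamming_dist z w = i})"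
    by auto
  also have "card \<dots> = (\<Sum>i = 0..R. card {w \<in> words q n. hamming_dist z w = i})"
    using finite_words by (intro card_UN_disjoint) auto
  finally show ?thesis
    unfolding ball_size_def card_hamming_sphere[OF assms] .
qed

lemma ball_size_pos: "ball_size q n R > 0"
proof -
  have "ball_size q n R \<ge> (q - 1) ^ 0 * (n choose 0)"
    unfolding ball_size_def by (rule member_le_sum) auto
  then show ?thesis by simp
qed

section \<open>Greedy partial coverings\<close>

text \<open>Averaging: the numbers of points of \<open>U\<close> covered by each \<open>c\<close>
  sum to \<open>card U * V\<close>, so some \<open>c\<close> covers at least the mean. The
  inequality is multiplied out to stay in the natural numbers.\<close>

lemma exists_point_covering_fraction:
  assumes "finite X" "X \<noteq> {}" "U \<subseteq> X" and deg: "\<And>u. u \<in> X \<Longrightarrow> card {c \<in> X. P c u} = V"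
  shows "\<exists>c \<in> X. card U * V \<le> card {u \<in> U. P c u} * card X"
proof (rule ccontr)
  assume "\<not> ?thesis"
  then have less: "card {u \<in> U. P c u} * card X < card U * V" if "c \<in> X" for c
    using that by auto
  have "(\<Sum>c\<in>X. card {u \<in> U. P c u}) = (\<Sum>u\<in>U. card {c \<in> X. P c u})"
    using assms by (intro sum_multicount_gen) (auto intro: finite_subset)
  also have "\<dots> = card U * V"
    using assms by (simp add: subset_iff)
  finally have "(\<Sum>c\<in>X. card {u \<in> U. P c u} * card X) = card U * V * card X"
    by (simp add: sum_distrib_right[symmetric])
  moreover have "(\<Sum>c\<in>X. card {u \<in> U. P c u} * card X) < (\<Sum>c\<in>X. card U * V)"
    using assms less by (intro sum_strict_mono) auto
  ultimately show False by simp
qed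

text \<open>Greedy choice: a point that covers at least the fraction \<open>V / card X\<close> of
  the still uncovered set shrinks that set by the factor \<open>1 - V / card X\<close>.\<close>

lemma greedy_partial_cover:
  assumes "finite X" "X \<noteq> {}" and deg: "\<And>u. u \<in> X \<Longrightarrow> card {c \<in> X. P c u} = V"
  shows "\<exists>K \<subseteq> X. card K \<le> k \<and>
    real (card {u \<in> X. \<forall>c \<in> K. \<not> P c u}) \<le> real (card X) * (1 - V / card X) ^ k"
proof (induction k)
  case 0
  show ?case by (intro exI[of _ "{}"]) simp
next
  case (Suc k)
  then obtain K where K: "K \<subseteq> X" "card K \<le> k"
    "real (card {u \<in> X. \<forall>c \<in> K. \<not> P c u}) \<le> real (card X) * (1 - V / card X) ^ k" by blast
  let ?U = "{u \<in> X. \<forall>c \<in> K. \<not> P c u}"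
  have cX: "card X > 0" using assms by (simp add: card_gt_0_iff)
  obtain u where "u \<in> X" using assms by blast
  \<comment> \<open>This makes the factor \<open>1 - V / card X\<close> nonnegative, so that the
    induction hypothesis can be multiplied by it.\<close>
  then have VX: "V \<le> card X"
    using card_mono[of X "{c \<in> X. P c u}"] assms by auto
  obtain c where c: "c \<in> X" "card ?U * V \<le> card {u \<in> ?U. P c u} * card X"
    using exists_point_covering_fraction[of X ?U P V] assms by blast
  have "{u \<in> X. \<forall>c' \<in> insert c K. \<not> P c' u} = ?U - {u \<in> ?U. P c u}"
    by auto
  moreover have "finite ?U" "{u \<in> ?U. P c u} \<subseteq> ?U"
    using assms(1) by auto
  ultimately have "real (card {u \<in> X. \<forall>c' \<in> insert c K. \<not> P c' u})
      = real (card ?U) - real (card {u \<in> ?U. P c u})"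
    by (simp only: card_Diff_subset[OF finite_subset] card_mono of_nat_diff)
  also have "\<dots> \<le> real (card ?U) - real (card ?U) * V / card X"
  proof -
    have "real (card ?U) * V \<le> real (card {u \<in> ?U. P c u}) * card X"
      using c(2) unfolding of_nat_mult[symmetric] of_nat_le_iff .
    then show ?thesis using cX by (simp add: divide_le_eq)
  qed
  also have "\<dots> = real (card ?U) * (1 - V / card X)"
    by (simp add: algebra_simps)
  also have "\<dots> \<le> real (card X) * (1 - V / card X) ^ k * (1 - V / card X)"
    using K(3) VX cX by (intro mult_right_mono) auto
  finally have "real (card {u \<in> X. \<forall>c' \<in> insert c K. \<not> P c' u})
      \<le> real (card X) * (1 - V / card X) ^ Suc k"
    by (simp add: algebra_simps)
  moreover have "card (insert c K) \<le> Suc k"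
    using K(2) finite_subset[OF K(1) assms(1)] by (simp add: card_insert_if)
  ultimately show ?case
    using K(1) c(1) by (intro exI[of _ "insert c K"]) auto
qed

text \<open>About \<open>x * q ^ n / V\<close> greedy steps suffice, by
  \<open>1 - t \<le> exp (- t)\<close>. Rounding the number of steps up secures the factor
  \<open>exp (- x)\<close> and costs at most one extra codeword, the summand 1.\<close>

lemma exists_partial_code:
  assumes "q \<ge> 1" "x > 0"
  shows "\<exists>K \<subseteq> words q n. real (card K) \<le> x * real q ^ n / ball_size q n R + 1 \<and>
    real (card {u \<in> words q n. \<forall>c \<in> K. hamming_dist u c > R}) \<le> exp (- x) * real q ^ n"
proof -
  let ?V = "ball_size q n R"
  define k where "k = nat \<lceil>x * real q ^ n / ?V\<rceil>"
  have V: "?V > 0" by (rule ball_size_pos)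
  have pos: "x * real q ^ n / ?V \<ge> 0" using assms by simp
  have k: "x * real q ^ n / ?V \<le> k" "k \<le> x * real q ^ n / ?V + 1"
    using pos unfolding k_def by linarith+
  have ne: "words q n \<noteq> {}"
    using card_words[of q n] assms by fastforce
  have deg: "card {c \<in> words q n. hamming_dist u c \<le> R} = ?V" if "u \<in> words q n" for u
    using that by (rule card_hamming_ball)
  obtain K where K: "K \<subseteq> words q n" "card K \<le> k"
    "real (card {u \<in> words q n. \<forall>c \<in> K. \<not> hamming_dist u c \<le> R})
      \<le> real (card (words q n)) * (1 - ?V / card (words q n)) ^ k"
    using greedy_partial_cover[OF finite_words ne, of "\<lambda>c u. hamming_dist u c \<le> R" ?V k, OF deg]
    by blast
  have "?V \<le> card (words q n)"
  proof -
    obtain u where "u \<in> words q n" using ne by blast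
    then show ?thesis
      using deg[of u] card_mono[of "words q n" "{c \<in> words q n. hamming_dist u c \<le> R}"]
      by (simp add: finite_words)
  qed
  \<comment> \<open>The base \<open>1 - ?V / real q ^ n\<close> is thus nonnegative, which
    monotonicity of powers requires.\<close>
  then have Vq: "real ?V \<le> real q ^ n"
    unfolding card_words by (metis of_nat_le_iff of_nat_power)
  have "(1 - ?V / real q ^ n) ^ k \<le> exp (- ?V / real q ^ n) ^ k"
    using Vq assms exp_ge_add_one_self[of "- ?V / real q ^ n"] by (intro power_mono) auto
  also have "\<dots> = exp (- (k * ?V / real q ^ n))"
    by (simp add: exp_of_nat_mult[symmetric])
  also have "\<dots> \<le> exp (- x)"
    using k(1) V assms by (simp add: field_simps)
  finally have "real q ^ n * (1 - ?V / real q ^ n) ^ k \<le> real q ^ n * exp (- x)"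
    by (rule mult_left_mono) simp
  then have "real (card {u \<in> words q n. \<forall>c \<in> K. hamming_dist u c > R}) \<le> exp (- x) * real q ^ n"
    using K(3) by (simp add: card_words not_le mult.commute)
  then show ?thesis using K k(2) by (intro exI[of _ K]) auto
qed

section \<open>The recursive inequality\<close>

lemma min_density_le: "covering_code q n R K \<Longrightarrow> min_density q n R \<le> density q n R K"
  unfolding min_density_def by (rule Min_le) (auto simp: finite_covering_codes)

lemma min_density_attained:
  obtains K where "covering_code q n R K" "density q n R K = min_density q n R"
proof -
  have "min_density q n R \<in> density q n R ` {K. covering_code q n R K}"
    unfolding min_density_def
    using covering_code_words by (intro Min_in) (auto simp: finite_covering_codes)
  then show ?thesis using that by auto
qed

lemma min_density_nonneg: "min_density q n R \<ge> 0"
proof -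
  obtain K where "density q n R K = min_density q n R"
    by (rule min_density_attained)
  then show ?thesis
    by (metis density_def divide_nonneg_nonneg mult_nonneg_nonneg of_nat_0_le_iff zero_le_power)
qed

text \<open>Each word keeps one of its two parts unchanged, so the whole radius is available for the
  other part. The summand \<open>ball_size q a R / real q ^ a\<close> is the cost of the extra
  codeword due to rounding.\<close>

lemma min_density_add_le:
  assumes q: "q \<ge> 1" and x: "x > 0"
  shows "min_density q (a + m) R \<le>
      (x + ball_size q a R / real q ^ a) * (ball_size q (a + m) R / ball_size q a R)
      + exp (- x) * (ball_size q (a + m) R / ball_size q m R) * min_density q m R"
proof -
  obtain K where K: "K \<subseteq> words q a" "real (card K) \<le> x * real q ^ a / ball_size q a R + 1"
    "real (card {u \<in> words q a. \<forall>c \<in> K. hamming_dist u c > R}) \<le> exp (- x) * real q ^ a"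
    using exists_partial_code[OF q x] by blast
  define U where "U = {u \<in> words q a. \<forall>c \<in> K. hamming_dist u c > R}"
  obtain L where L: "covering_code q m R L" "density q m R L = min_density q m R"
    by (rule min_density_attained)
  have Lw: "L \<subseteq> words q m" using L(1) by (simp add: covering_code_def)
  define C where "C = (\<lambda>(u, v). u @ v) ` (K \<times> words q m \<union> U \<times> L)"
  have fin: "finite K" "finite U" "finite L"
    using K(1) Lw finite_words unfolding U_def by (auto intro: finite_subset)
  have "covering_code q (a + m) R C"
    unfolding covering_code_def
  proof (intro conjI ballI)
    show "C \<subseteq> words q (a + m)"
      using K(1) Lw unfolding C_def U_def by (auto intro!: append_in_words)
  next
    fix z assume "z \<in> words q (a + m)"
    then obtain u v where z: "z = u @ v" "u \<in> words q a" "v \<in> words q m"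
      by (rule words_add_cases)
    show "\<exists>c \<in> C. hamming_dist z c \<le> R"
    proof (cases "u \<in> U")
      case True
      obtain c where c: "c \<in> L" "hamming_dist v c \<le> R"
        using L(1) z(3) by (auto simp: covering_code_def)
      then have "u @ c \<in> C" using True unfolding C_def by force
      then show ?thesis
        using c z(1) by (intro bexI[of _ "u @ c"]) (auto simp: hamming_dist_append)
    next
      case False
      then obtain c where c: "c \<in> K" "hamming_dist u c \<le> R"
        using z(2) unfolding U_def by force
      then have "c @ v \<in> C" using z(3) unfolding C_def by force
      moreover have "length u = length c"
        using K(1) c(1) z(2) by (auto simp: words_def)
      ultimately show ?thesis
        using c z(1) by (intro bexI[of _ "c @ v"]) (auto simp: hamming_dist_append)
    qed
  qed
  then have "min_density q (a + m) R \<le> density q (a + m) R C"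
    by (rule min_density_le)
  also have "\<dots> \<le> ((x * real q ^ a / ball_size q a R + 1) * real q ^ m + exp (- x) * real q ^ a * card L)
      * ball_size q (a + m) R / real q ^ (a + m)"
  proof -
    have "card C \<le> card (K \<times> words q m \<union> U \<times> L)"
      unfolding C_def using fin by (intro card_image_le) (auto simp: finite_words)
    also have "\<dots> \<le> card K * q ^ m + card U * card L"
      by (rule order_trans[OF card_Un_le]) (simp add: card_cartesian_product card_words)
    finally have "real (card C) \<le> real (card K * q ^ m + card U * card L)"
      by (rule of_nat_mono)
    also have "\<dots> = real (card K) * real q ^ m + real (card U) * card L"
      by simp
    also have "\<dots> \<le> (x * real q ^ a / ball_size q a R + 1) * real q ^ m + exp (- x) * real q ^ a * card L"
      using K(2,3) unfolding U_def by (intro add_mono mult_right_mono) auto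
    finally show ?thesis
      unfolding density_def by (intro divide_right_mono mult_right_mono) auto
  qed
  also have "\<dots> = (x + ball_size q a R / real q ^ a) * (ball_size q (a + m) R / ball_size q a R)
      + exp (- x) * (ball_size q (a + m) R / ball_size q m R) * density q m R L"
  proof -
    \<comment> \<open>Here \<open>Q\<close> and \<open>M\<close> stand for the powers of
      \<open>q\<close>, \<open>v\<close>, \<open>w\<close> and \<open>V\<close> for the ball sizes
      in lengths \<open>a\<close>, \<open>m\<close> and \<open>a + m\<close>, \<open>l\<close> for
      \<open>card L\<close> and \<open>E\<close> for \<open>exp (- x)\<close>.\<close>
    have identity: "((x * Q / v + 1) * M + E * Q * l) * V / (Q * M)
        = (x + v / Q) * (V / v) + E * (V / w) * (l * w / M)"
      if "Q \<noteq> 0" "M \<noteq> 0" "v \<noteq> 0" "w \<noteq> 0" for Q M v w l V E :: real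
      using that by (simp add: field_simps)
    then show ?thesis
      using q ball_size_pos[of q a R] ball_size_pos[of q m R]
      unfolding density_def power_add by (intro identity) auto
  qed
  finally show ?thesis using L(2) by simp
qed

section \<open>Asymptotics of ball sizes\<close>

text \<open>Passing from \<open>k\<close> to \<open>Suc k\<close> multiplies the quotient by
  \<open>(1 - k / n) / Suc k\<close>, and \<open>k / n\<close> vanishes in the limit.\<close>

lemma binomial_div_power_tendsto:
  "(\<lambda>n. real (n choose k) / real n ^ k) \<longlonglongrightarrow> 1 / fact k"
proof (induction k)
  case 0
  show ?case by simp
next
  case (Suc k)
  have "(\<lambda>n. 1 - real k * (1 / real n)) \<longlonglongrightarrow> 1 - real k * 0"
    by (intro tendsto_intros lim_1_over_n)
  then have "(\<lambda>n. real (n choose k) / real n ^ k * (1 - real k * (1 / real n)) / Suc k)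
      \<longlonglongrightarrow> 1 / fact k * (1 - real k * 0) / Suc k"
    by (intro tendsto_intros Suc.IH) auto
  moreover have "\<forall>\<^sub>F n in sequentially.
      real (n choose k) / real n ^ k * (1 - real k * (1 / real n)) / Suc k
      = real (n choose Suc k) / real n ^ Suc k"
    \<comment> \<open>For such \<open>n\<close> the difference \<open>n - k\<close> is not truncated
      and division by \<open>n\<close> is harmless.\<close>
    using eventually_ge_at_top[of "Suc k"]
  proof eventually_elim
    case (elim n)
    have "Suc k * (n choose Suc k) = (n - k) * (n choose k)"
      using binomial_absorb_comp[of n k] Suc_times_binomial_eq[of "n - 1" k] elim
        binomial_absorption[of k n] by simp
    then have "real (Suc k) * real (n choose Suc k) = (real n - real k) * real (n choose k)"
      using elim by (metis Suc_leD of_nat_diff of_nat_mult)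
    then have "real (n choose Suc k) = (real n - real k) * real (n choose k) / real (Suc k)"
      by (simp add: field_simps del: of_nat_Suc)
    moreover have "1 - real k * (1 / real n) = (real n - real k) / real n"
      using elim by (simp add: field_simps)
    ultimately show ?case by (simp add: mult_ac)
  qed
  ultimately show ?case
    by (auto elim!: Lim_transform_eventually simp: field_simps)
qed

text \<open>Only the outermost sphere, \<open>i = R\<close>, has order \<open>n ^ R\<close>; each
  smaller sphere contributes a convergent factor times a positive power of
  \<open>1 / n\<close>.\<close>

lemma ball_size_div_power_tendsto:
  "(\<lambda>n. ball_size q n R / real n ^ R) \<longlonglongrightarrow> (real (q - 1)) ^ R / fact R"
proof -
  have "(\<lambda>n. (q - 1) ^ i * real (n choose i) / real n ^ R)
      \<longlonglongrightarrow> (if i = R then (real (q - 1)) ^ R / fact R else 0)" if "i \<in> {0..R}" for i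
  proof (cases "i = R")
    case True
    then show ?thesis
      using tendsto_mult_left[OF binomial_div_power_tendsto[of R], of "real (q - 1) ^ R"] by simp
  next
    case False
    with that obtain d where d: "R = i + d" "d > 0"
      by (metis atLeastAtMost_iff le_Suc_ex le_neq_implies_less less_add_same_cancel1)
    have "(\<lambda>n. (q - 1) ^ i * (real (n choose i) / real n ^ i * (1 / real n) ^ d))
        \<longlonglongrightarrow> (q - 1) ^ i * (1 / fact i * 0 ^ d)"
      by (intro tendsto_intros lim_1_over_n binomial_div_power_tendsto)
    then show ?thesis using d by (simp add: power_add power_divide zero_power)
  qed
  then have "(\<lambda>n. \<Sum>i = 0..R. (q - 1) ^ i * real (n choose i) / real n ^ R)
      \<longlonglongrightarrow> (\<Sum>i = 0..R. if i = R then (real (q - 1)) ^ R / fact R else 0)"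
    by (rule tendsto_sum)
  then show ?thesis
    by (simp add: ball_size_def sum_divide_distrib)
qed

text \<open>Both balls grow like the same constant times the \<open>R\<close>-th power of the
  length, so the ratio behaves like \<open>(n / g n) ^ R\<close>. The constant is nonzero because
  \<open>q \<ge> 2\<close>.\<close>

lemma ball_size_ratio_tendsto:
  assumes q: "q \<ge> 2" and c: "c > 0" and g: "(\<lambda>n. real (g n) / real n) \<longlonglongrightarrow> c"
    and g': "filterlim g at_top sequentially"
  shows "(\<lambda>n. ball_size q n R / ball_size q (g n) R) \<longlonglongrightarrow> (1 / c) ^ R"
proof -
  let ?L = "real (q - 1) ^ R / fact R"
  have L: "?L \<noteq> 0" using q by simp
  have "(\<lambda>n. (ball_size q n R / real n ^ R) / (ball_size q (g n) R / real (g n) ^ R)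
      * (1 / (real (g n) / real n)) ^ R) \<longlonglongrightarrow> ?L / ?L * (1 / c) ^ R"
    using L c by (intro tendsto_intros ball_size_div_power_tendsto g
      filterlim_compose[OF ball_size_div_power_tendsto g']) auto
  then have "(\<lambda>n. (ball_size q n R / real n ^ R) / (ball_size q (g n) R / real (g n) ^ R)
      * (1 / (real (g n) / real n)) ^ R) \<longlonglongrightarrow> (1 / c) ^ R"
    unfolding divide_self[OF L] mult_1_left .
  moreover have "\<forall>\<^sub>F n in sequentially. g n \<ge> 1"
    using g' by (simp add: filterlim_at_top)
  then have "\<forall>\<^sub>F n in sequentially.
      (ball_size q n R / real n ^ R) / (ball_size q (g n) R / real (g n) ^ R)
      * (1 / (real (g n) / real n)) ^ R = ball_size q n R / ball_size q (g n) R"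
    using eventually_gt_at_top[of 0]
    by eventually_elim (simp add: field_simps)
  ultimately show ?thesis by (rule Lim_transform_eventually)
qed

text \<open>Polynomial growth of the ball against \<open>q ^ n\<close>, written as
  \<open>exp (ln q * n)\<close>. This makes the rounding cost in the recursion vanish.\<close>

lemma ball_fraction_tendsto_0:
  assumes "q \<ge> 2"
  shows "(\<lambda>n. ball_size q n R / real q ^ n) \<longlonglongrightarrow> 0"
proof -
  have lnq: "ln (real q) > 0" using assms by simp
  have "filterlim (\<lambda>n. ln (real q) * real n) at_top sequentially"
    by (intro filterlim_tendsto_pos_mult_at_top[OF tendsto_const lnq] filterlim_real_sequentially)
  from filterlim_compose[OF tendsto_power_div_exp_0 this]
  have "(\<lambda>n. (ln (real q) * real n) ^ R / exp (ln (real q) * real n)) \<longlonglongrightarrow> 0" .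
  moreover have "exp (ln (real q) * real n) = real q ^ n" for n
    using assms by (subst mult.commute) (simp add: exp_of_nat_mult)
  ultimately have "(\<lambda>n. (ln (real q) * real n) ^ R / real q ^ n) \<longlonglongrightarrow> 0"
    by simp
  then have "(\<lambda>n. ball_size q n R / real n ^ R * ((ln (real q) * real n) ^ R / real q ^ n)
      / ln (real q) ^ R) \<longlonglongrightarrow> real (q - 1) ^ R / fact R * 0 / ln (real q) ^ R"
    using lnq by (intro tendsto_intros ball_size_div_power_tendsto) auto
  then have "(\<lambda>n. ball_size q n R / real n ^ R * ((ln (real q) * real n) ^ R / real q ^ n)
      / ln (real q) ^ R) \<longlonglongrightarrow> 0"
    by simp
  moreover have "\<forall>\<^sub>F n in sequentially.
      ball_size q n R / real n ^ R * ((ln (real q) * real n) ^ R / real q ^ n) / ln (real q) ^ R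
      = ball_size q n R / real q ^ n"
    using eventually_gt_at_top[of 0]
    by eventually_elim (use lnq in \<open>simp add: power_mult_distrib\<close>)
  ultimately show ?thesis by (rule Lim_transform_eventually)
qed

section \<open>Limit superior under a contracting recursion\<close>

text \<open>Finiteness has to come first: an infinite limit superior would satisfy the limiting
  inequality trivially. A bound that survives one step of the recursion propagates by strong
  induction.\<close>

lemma bounded_of_contracting_recursion:
  fixes f A B :: "nat \<Rightarrow> real" and g :: "nat \<Rightarrow> nat"
  assumes f: "\<And>n. f n \<ge> 0" and rec: "\<forall>\<^sub>F n in sequentially. f n \<le> A n + B n * f (g n)"
    and g: "\<forall>\<^sub>F n in sequentially. g n < n"
    and A: "A \<longlonglongrightarrow> \<alpha>" and B: "B \<longlonglongrightarrow> \<beta>" and \<beta>: "0 \<le> \<beta>" "\<beta> < 1"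
  shows "\<exists>C. \<forall>n. f n \<le> C"
proof -
  \<comment> \<open>The midpoint of \<beta> and 1 leaves room for \<open>B n\<close> to lie
    eventually below \<open>b\<close> while \<open>b\<close> stays below 1.\<close>
  define b where "b = (\<beta> + 1) / 2"
  have b: "0 \<le> b" "\<beta> < b" "b < 1" using \<beta> by (auto simp: b_def)
  have "\<forall>\<^sub>F n in sequentially. A n < \<alpha> + 1"
    using A by (rule order_tendstoD) simp
  moreover have "\<forall>\<^sub>F n in sequentially. B n < b"
    using B b(2) by (rule order_tendstoD)
  ultimately have "\<forall>\<^sub>F n in sequentially. f n \<le> (\<alpha> + 1) + b * f (g n) \<and> g n < n"
    using rec g
  proof eventually_elim
    case (elim n)
    then have "B n * f (g n) \<le> b * f (g n)"
      using f by (intro mult_right_mono) auto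
    then show ?case using elim by auto
  qed
  then obtain N where N: "\<And>n. n \<ge> N \<Longrightarrow> f n \<le> (\<alpha> + 1) + b * f (g n)" "\<And>n. n \<ge> N \<Longrightarrow> g n < n"
    unfolding eventually_sequentially by blast
  \<comment> \<open>The first entry is the fixed point of
    \<open>t \<mapsto> (\<alpha> + 1) + b * t\<close>, above which one step cannot increase the
    bound; the others cover the initial values.\<close>
  define C where "C = Max (insert ((\<alpha> + 1) / (1 - b)) (f ` {..N}))"
  have C: "(\<alpha> + 1) / (1 - b) \<le> C" "\<And>n. n \<le> N \<Longrightarrow> f n \<le> C"
    unfolding C_def by (auto intro!: Max_ge simp del: Max_insert)
  have step: "(\<alpha> + 1) + b * C \<le> C"
    using C(1) b(3) by (simp add: field_simps)
  have "f n \<le> C" for n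
  proof (induction n rule: less_induct)
    case (less n)
    show ?case
    proof (cases "n \<le> N")
      case True
      then show ?thesis by (rule C)
    next
      case False
      then have "f n \<le> (\<alpha> + 1) + b * f (g n)" "f (g n) \<le> C"
        using N[of n] less.IH by auto
      moreover have "b * f (g n) \<le> b * C"
        using calculation(2) b(1) by (rule mult_left_mono)
      ultimately show ?thesis using step by linarith
    qed
  qed
  then show ?thesis by blast
qed

text \<open>The limit superior \<open>l\<close> is finite and satisfies
  \<open>l \<le> \<alpha> + \<beta> * l\<close>, which is solved for \<open>l\<close>.\<close>

lemma limsup_le_of_contracting_recursion:
  fixes f A B :: "nat \<Rightarrow> real" and g :: "nat \<Rightarrow> nat"
  assumes f: "\<And>n. f n \<ge> 0" and rec: "\<forall>\<^sub>F n in sequentially. f n \<le> A n + B n * f (g n)"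
    and g: "\<forall>\<^sub>F n in sequentially. g n < n" and g': "filterlim g at_top sequentially"
    and A: "A \<longlonglongrightarrow> \<alpha>" and B: "B \<longlonglongrightarrow> \<beta>" and \<beta>: "\<beta> < 1" and B0: "\<And>n. B n \<ge> 0"
  shows "limsup (\<lambda>n. ereal (f n)) \<le> ereal (\<alpha> / (1 - \<beta>))"
proof -
  let ?L = "limsup (\<lambda>n. ereal (f n))"
  have \<beta>0: "\<beta> \<ge> 0"
    using B B0 by (intro LIMSEQ_le_const[OF B]) auto
  obtain C where C: "\<And>n. f n \<le> C"
    using bounded_of_contracting_recursion[OF f rec g A B \<beta>0 \<beta>] by blast
  have "?L \<le> ereal C"
    using C by (intro Limsup_bounded) auto
  moreover have "0 \<le> ?L"
    using f by (intro le_Limsup) auto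
  ultimately obtain l where l: "?L = ereal l"
    by (cases ?L) auto
  \<comment> \<open>Any \<open>c > l\<close> eventually bounds \<open>f\<close>, hence also
    \<open>f (g n)\<close> since \<open>g\<close> tends to infinity; one step of the recursion then
    bounds \<open>l\<close>.\<close>
  have iter: "l \<le> \<alpha> + \<beta> * c" if "l < c" for c
  proof -
    have "\<forall>\<^sub>F n in sequentially. ereal (f n) < ereal c"
      using l that by (intro Limsup_lessD) simp
    then have "\<forall>\<^sub>F n in sequentially. f (g n) < c"
      using eventually_compose_filterlim[OF _ g', of "\<lambda>n. f n < c"] by simp
    with rec have "\<forall>\<^sub>F n in sequentially. ereal (f n) \<le> ereal (A n + B n * c)"
    proof eventually_elim
      case (elim n)
      then have "B n * f (g n) \<le> B n * c"
        using B0 by (intro mult_left_mono) auto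
      with elim show ?case by simp
    qed
    then have "?L \<le> limsup (\<lambda>n. ereal (A n + B n * c))"
      by (rule Limsup_mono)
    also have "\<dots> = ereal (\<alpha> + \<beta> * c)"
      by (intro lim_imp_Limsup tendsto_intros A B) simp
    finally show ?thesis using l by simp
  qed
  \<comment> \<open>Let \<open>c\<close> decrease to \<open>l\<close>.\<close>
  have "l \<le> \<alpha> + \<beta> * l"
  proof (rule field_le_epsilon)
    fix e :: real assume "e > 0"
    then have "l \<le> \<alpha> + \<beta> * (l + e)" by (intro iter) simp
    also have "\<dots> \<le> \<alpha> + \<beta> * l + e"
      using \<beta> \<open>e > 0\<close> by (simp add: algebra_simps mult_left_le)
    finally show "l \<le> \<alpha> + \<beta> * l + e" .
  qed
  then have "l \<le> \<alpha> / (1 - \<beta>)"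
    using \<beta> by (simp add: field_simps)
  then show ?thesis using l by simp
qed

section \<open>Rounded lengths and linear growth\<close>

lemma floor_div_tendsto:
  fixes y :: real
  assumes "y > 0"
  shows "(\<lambda>n. real (nat \<lfloor>real n / y\<rfloor>) / real n) \<longlonglongrightarrow> 1 / y"
proof (rule tendsto_sandwich)
  have bounds: "real n / y - 1 \<le> real (nat \<lfloor>real n / y\<rfloor>)" "real (nat \<lfloor>real n / y\<rfloor>) \<le> real n / y" for n
    using assms by auto
  show "\<forall>\<^sub>F n in sequentially. 1 / y - 1 / real n \<le> real (nat \<lfloor>real n / y\<rfloor>) / real n"
    using eventually_gt_at_top[of 0]
  proof eventually_elim
    case (elim n)
    have "1 / y - 1 / real n = (real n / y - 1) / real n"
      using elim by (simp add: field_simps)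
    then show ?case using bounds(1)[of n] by (simp add: divide_right_mono)
  qed
  show "\<forall>\<^sub>F n in sequentially. real (nat \<lfloor>real n / y\<rfloor>) / real n \<le> 1 / y"
    using eventually_gt_at_top[of 0]
  proof eventually_elim
    case (elim n)
    have "1 / y = (real n / y) / real n"
      using elim by (simp add: field_simps)
    then show ?case using bounds(2)[of n] by (metis divide_right_mono of_nat_0_le_iff)
  qed
  show "(\<lambda>n. 1 / y - 1 / real n) \<longlonglongrightarrow> 1 / y"
    using tendsto_diff[OF tendsto_const lim_1_over_n, of "1 / y"] by simp
qed simp

text \<open>Ensures that prefix and suffix lengths both tend to infinity, so that the ball
  asymptotics apply along them.\<close>

lemma filterlim_at_top_of_linear_growth:
  fixes g :: "nat \<Rightarrow> nat"
  assumes "(\<lambda>n. real (g n) / real n) \<longlonglongrightarrow> c" "c > 0"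
  shows "filterlim g at_top sequentially"
proof -
  have "filterlim (\<lambda>n. real (g n) / real n * real n) at_top sequentially"
    using assms by (rule filterlim_tendsto_pos_mult_at_top) (rule filterlim_real_sequentially)
  moreover have "\<forall>\<^sub>F n in sequentially. real (g n) / real n * real n = real (g n)"
    using eventually_gt_at_top[of 0] by eventually_elim simp
  ultimately have "filterlim (\<lambda>n. real (g n)) at_top sequentially"
    by (rule filterlim_mono_eventually[OF _ order_refl order_refl])
  then show ?thesis
    by (simp add: filterlim_sequentially_iff_filterlim_real)
qed

section \<open>Splitting the length according to \<open>y\<close> and solving the recursion\<close>

theorem theorem1:
  fixes q R :: nat and x y :: real
  assumes "q \<ge> 2" and "R \<ge> 1" and "y > 1" and "x > 0"
    and "exp (- x) * y ^ R < 1"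
  shows "limsup_density q R
    \<le> ereal (x * (y / (y - 1)) ^ R * (1 + 1 / (exp x * y powi (- int R) - 1)))"
proof -
  \<comment> \<open>The suffix takes the fraction \<open>1 / y\<close> of the length and the prefix
    the rest, so the ball ratios tend to \<open>y ^ R\<close> and
    \<open>(y / (y - 1)) ^ R\<close>.\<close>
  define m where "m n = nat \<lfloor>real n / y\<rfloor>" for n
  define a where "a n = n - m n" for n
  let ?V = "\<lambda>n. ball_size q n R"
  define A where "A n = (x + ?V (a n) / real q ^ a n) * (?V n / ?V (a n))" for n
  define B where "B n = exp (- x) * (?V n / ?V (m n))" for n
  let ?\<alpha> = "x * (y / (y - 1)) ^ R" and ?\<beta> = "exp (- x) * y ^ R"
  have m_less: "m n < n" if "n > 0" for n
  proof -
    have "real n / y < real n"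
      using assms(3) that by (simp add: divide_less_eq)
    then show ?thesis unfolding m_def using that by linarith
  qed
  \<comment> \<open>Since \<open>m n\<close> never exceeds \<open>n\<close>, the subtraction in
    \<open>a n\<close> is exact; \<open>n = 0\<close> is separate because \<open>m_less\<close> is
    strict.\<close>
  then have am: "a n + m n = n" for n
    unfolding a_def by (cases "n = 0") (auto simp: m_def less_imp_le)
  have m_ratio: "(\<lambda>n. real (m n) / real n) \<longlonglongrightarrow> 1 / y"
    unfolding m_def using assms(3) by (intro floor_div_tendsto) simp
  have "\<forall>\<^sub>F n in sequentially. 1 - real (m n) / real n = real (a n) / real n"
    using eventually_gt_at_top[of 0]
  proof eventually_elim
    case (elim n)
    have "real n = real (a n) + real (m n)" using am[of n] by linarith
    then show ?case using elim by (simp add: field_simps)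
  qed
  then have a_ratio: "(\<lambda>n. real (a n) / real n) \<longlonglongrightarrow> 1 - 1 / y"
    by (rule Lim_transform_eventually[rotated]) (intro tendsto_intros m_ratio)
  have ypos: "1 / y > 0" "1 - 1 / y > 0"
    using assms(3) by auto
  have m_top: "filterlim m at_top sequentially" and a_top: "filterlim a at_top sequentially"
    using filterlim_at_top_of_linear_growth m_ratio a_ratio ypos by blast+
  \<comment> \<open>The summand 0 is the limit of the rounding cost.\<close>
  have "A \<longlonglongrightarrow> (x + 0) * (1 / (1 - 1 / y)) ^ R"
    unfolding A_def using assms(1) ypos
    by (intro tendsto_intros ball_size_ratio_tendsto a_ratio a_top
      filterlim_compose[OF ball_fraction_tendsto_0 a_top])
  moreover have "1 / (1 - 1 / y) = y / (y - 1)"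
    using assms(3) by (simp add: field_simps)
  ultimately have A: "A \<longlonglongrightarrow> ?\<alpha>" by simp
  have "B \<longlonglongrightarrow> exp (- x) * (1 / (1 / y)) ^ R"
    unfolding B_def using assms(1) ypos
    by (intro tendsto_intros ball_size_ratio_tendsto m_ratio m_top)
  then have B: "B \<longlonglongrightarrow> ?\<beta>" by simp
  have "min_density q n R \<le> A n + B n * min_density q (m n) R" for n
    using min_density_add_le[of q x "a n" "m n" R] assms(1,4)
    unfolding A_def B_def am by simp
  then have "limsup_density q R \<le> ereal (?\<alpha> / (1 - ?\<beta>))"
    unfolding limsup_density_def
    using m_less min_density_nonneg eventually_mono[OF eventually_gt_at_top[of 0], of "\<lambda>n. m n < n"]
    by (intro limsup_le_of_contracting_recursion[OF _ _ _ m_top A B assms(5)]) (auto simp: B_def)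
  moreover have "1 + 1 / (exp x * y powi (- int R) - 1) = 1 / (1 - ?\<beta>)"
  proof -
    \<comment> \<open>The expression in the statement is the reciprocal of \<open>?\<beta>\<close>,
      which turns the last factor into the geometric sum \<open>1 / (1 - ?\<beta>)\<close>.\<close>
    have "exp x * y powi (- int R) = 1 / ?\<beta>"
      by (simp add: power_int_minus exp_minus field_simps)
    moreover have "?\<beta> > 0" using assms(3) by simp
    moreover have "1 + 1 / (1 / b - 1) = 1 / (1 - b)" if "0 < b" "b < 1" for b :: real
      using that by (simp add: field_simps)
    ultimately show ?thesis using assms(5) by simp
  qed
  ultimately show ?thesis by simp
qed

end
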